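(* Let $T$ be a finite tree of order $n\ge 2$. Then the following statements are equivalent: (i) $T$ is well-covered; (ii) $T$ is very well-covered; (iii) $T$ has a perfect matching consisting of pendant edges; (iv) $T$ is square-stable, i.e. $\alpha(T)=\alpha(T^2)$.
   Context: $G^2$ is the graph on $V(G)$ in which distinct vertices $v,w$ are adjacent iff $\mathrm{dist}_G(v,w)\le 2$. $\alpha(G)$ is the maximum cardinality of a stable (independent) set. A pendant edge is an edge having at least one endpoint of degree $1$. $G$ is well-covered if it has no isolated vertices and every (inclusion-)maximal stable set has cardinality $\alpha(G)$; $G$ is very well-covered if it is well-covered and $|V(G)|=2\alpha(G)$. *)

theory Defs
  imports
    "Graph_Theory.Digraph_Component"
    "Graph_Theory.Pair_Digraph"
    "Graph_Theory.Shortest_Path"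
begin

text \<open>
  A finite simple graph is a \<open>pair_graph\<close>: a finite, loop-free, symmetric digraph on the
  vertex set \<open>pverts G\<close>. Each undirected edge \<open>uv\<close> is represented by the two arcs \<open>(u, v)\<close>
  and \<open>(v, u)\<close>, so \<open>out_degree\<close> is the usual degree.
\<close>

definition uedges :: "'a pair_pre_digraph \<Rightarrow> 'a set set" where
  "uedges G = {{u, v} | u v. (u, v) \<in> parcs G}"

text \<open>
  The predicate \<open>tree\<close> of \<open>Digraph_Component\<close> is about directed cycles; in a symmetric digraph
  every edge yields the closed walk \<open>[(u, v), (v, u)]\<close>, which \<open>cycle\<close> accepts. In a loop-free
  symmetric digraph the cycles of the undirected graph are those of length at least 3.
\<close>

definition graph_tree :: "'a pair_pre_digraph \<Rightarrow> bool" where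
  "graph_tree G \<longleftrightarrow> pair_graph G \<and> Digraph_Component.connected (with_proj G) \<and>
     \<not> (\<exists>p. pre_digraph.cycle (with_proj G) p \<and> 3 \<le> length p)"

text \<open>The infimum of the lengths of all walks; it is \<open>\<infinity>\<close> between different components.\<close>

definition graph_dist :: "'a pair_pre_digraph \<Rightarrow> 'a \<Rightarrow> 'a \<Rightarrow> ereal" where
  "graph_dist G = wf_digraph.\<mu> (with_proj G) (\<lambda>_. 1)"

definition graph_square :: "'a pair_pre_digraph \<Rightarrow> 'a pair_pre_digraph" where
  "graph_square G =
     \<lparr>pverts = pverts G,
      parcs = {(v, w). v \<in> pverts G \<and> w \<in> pverts G \<and> v \<noteq> w \<and> graph_dist G v w \<le> 2}\<rparr>"

definition stable :: "'a pair_pre_digraph \<Rightarrow> 'a set \<Rightarrow> bool" where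
  "stable G S \<longleftrightarrow> S \<subseteq> pverts G \<and> (\<forall>u\<in>S. \<forall>v\<in>S. (u, v) \<notin> parcs G)"

definition maximal_stable :: "'a pair_pre_digraph \<Rightarrow> 'a set \<Rightarrow> bool" where
  "maximal_stable G S \<longleftrightarrow> stable G S \<and> (\<forall>S'. stable G S' \<longrightarrow> S \<subseteq> S' \<longrightarrow> S' = S)"

definition stability_number :: "'a pair_pre_digraph \<Rightarrow> nat" where
  "stability_number G = Max (card ` {S. stable G S})"

definition well_covered :: "'a pair_pre_digraph \<Rightarrow> bool" where
  "well_covered G \<longleftrightarrow>
     (\<forall>v\<in>pverts G. out_degree (with_proj G) v \<noteq> 0) \<and>
     (\<forall>S. maximal_stable G S \<longrightarrow> card S = stability_number G)"

definition very_well_covered :: "'a pair_pre_digraph \<Rightarrow> bool" where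
  "very_well_covered G \<longleftrightarrow> well_covered G \<and> card (pverts G) = 2 * stability_number G"

definition square_stable :: "'a pair_pre_digraph \<Rightarrow> bool" where
  "square_stable G \<longleftrightarrow> stability_number G = stability_number (graph_square G)"

definition pendant_edge :: "'a pair_pre_digraph \<Rightarrow> 'a set \<Rightarrow> bool" where
  "pendant_edge G e \<longleftrightarrow> e \<in> uedges G \<and> (\<exists>v\<in>e. out_degree (with_proj G) v = 1)"

definition matching :: "'a pair_pre_digraph \<Rightarrow> 'a set set \<Rightarrow> bool" where
  "matching G M \<longleftrightarrow> M \<subseteq> uedges G \<and> pairwise disjnt M"

definition perfect_matching :: "'a pair_pre_digraph \<Rightarrow> 'a set set \<Rightarrow> bool" where
  "perfect_matching G M \<longleftrightarrow> matching G M \<and> \<Union>M = pverts G"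

end

theory Submission
  imports Defs
begin

text \<open>
  In a forest the stability number \<open>\<alpha>\<close> equals the least number of edges and single vertices
  into which the vertex set can be partitioned. A stable set meets each part of such a partition
  at most once, so the equality says that some partition \<open>P\<close> has exactly \<open>\<alpha>\<close> parts, and then
  \<^emph>\<open>every\<close> stable set of size \<open>\<alpha>\<close> is a transversal of \<open>P\<close>. The partition is built by induction: a
  vertex with at most one remaining neighbour is split off together with that neighbour
  (\<open>acyclic_partition_of_stable_size\<close>). Fix such a \<open>P\<close>.

  If the graph is well-covered, every stable set extends to one of size \<open>\<alpha>\<close>, hence to a
  transversal of \<open>P\<close>. So \<open>{v}\<close> is not a part, because a neighbour of \<open>v\<close> is a stable set that cannot
  be extended by \<open>v\<close>; hence \<open>P\<close> is a perfect matching. If both ends of a part \<open>{x, y}\<close> had a further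
  neighbour, \<open>a\<close> of \<open>x\<close> and \<open>b\<close> of \<open>y\<close>, then \<open>{a, b}\<close> would be stable (there are no triangles and no
  4-cycles) and no stable set containing it could meet \<open>{x, y}\<close>. So every part is pendant
  (\<open>acyclic_well_covered_pendant_matching\<close>).

  If the graph is square-stable, some transversal \<open>S\<close> of \<open>P\<close> is stable even in the square. For
  \<open>x \<in> S\<close> and a neighbour \<open>z\<close> of \<open>x\<close>, the representative of the part of \<open>z\<close> is within distance 2 of
  \<open>x\<close>, so it is \<open>x\<close> itself. Thus all neighbours of \<open>x\<close> lie in the part of \<open>x\<close>: without isolated
  vertices each part is an edge, and its representative is a leaf
  (\<open>acyclic_square_stable_pendant_matching\<close>).

  Conversely, let \<open>M\<close> be a perfect matching of pendant edges in any finite graph. One leaf from each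
  edge of \<open>M\<close> gives a set of size \<open>card M\<close> that is stable in the square, since each leaf has
  its partner in \<open>M\<close> as only neighbour and the partners are pairwise distinct; so both
  stability numbers equal \<open>card M\<close>. A maximal stable set avoiding the partner of such a leaf contains the leaf, so it has size \<open>card M\<close> as well
  (\<open>pendant_matching_card\<close> and \<open>pendant_matching_very_well_covered\<close>).
\<close>

section \<open>Stable sets\<close>

text \<open>
  Sending each element of \<open>S\<close> to a member of \<open>P\<close> that contains it is injective, and it is
  surjective as soon as the cardinalities agree. This counting argument turns equality of
  cardinalities into the existence of a representative in each part.
\<close>

lemma transversal_card_le:
  assumes "finite P" and "S \<subseteq> \<Union>P"
    and once: "\<And>e x y. e \<in> P \<Longrightarrow> x \<in> S \<inter> e \<Longrightarrow> y \<in> S \<inter> e \<Longrightarrow> x = y"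
  shows "card S \<le> card P"
    and "card S = card P \<Longrightarrow> e \<in> P \<Longrightarrow> S \<inter> e \<noteq> {}"
proof -
  from \<open>S \<subseteq> \<Union>P\<close> have "\<forall>x\<in>S. \<exists>e. e \<in> P \<and> x \<in> e" by blast
  then obtain f where f: "\<And>x. x \<in> S \<Longrightarrow> f x \<in> P \<and> x \<in> f x" by metis
  have inj: "inj_on f S"
    by (rule inj_onI) (metis IntI f once)
  have sub: "f ` S \<subseteq> P" using f by blast
  show "card S \<le> card P"
    using card_inj_on_le[OF inj sub \<open>finite P\<close>] .
  show "S \<inter> e \<noteq> {}" if "card S = card P" "e \<in> P"
  proof -
    have "f ` S = P"
      using card_subset_eq[OF \<open>finite P\<close> sub] card_image[OF inj] that(1) by simp
    then show ?thesis using f that(2) by blast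
  qed
qed

lemma finite_stable_sets: "finite (pverts G) \<Longrightarrow> finite {S. stable G S}"
  by (rule finite_subset[of _ "Pow (pverts G)"]) (auto simp: stable_def)

lemma stable_card_le_stability_number:
  assumes "finite (pverts G)" and "stable G S"
  shows "card S \<le> stability_number G"
  unfolding stability_number_def
  using finite_stable_sets[OF assms(1)] assms(2) by (intro Max_ge) auto

lemma stability_number_attained:
  assumes "finite (pverts G)"
  obtains S where "stable G S" and "card S = stability_number G"
proof -
  have "stable G {}" by (simp add: stable_def)
  then have "stability_number G \<in> card ` {S. stable G S}"
    unfolding stability_number_def
    using finite_stable_sets[OF assms] by (intro Max_in) auto
  then show thesis using that by auto
qed

lemma stable_finite: "finite (pverts G) \<Longrightarrow> stable G S \<Longrightarrow> finite S"
  by (auto simp: stable_def intro: finite_subset)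

lemma stable_extends_to_maximal:
  assumes fin: "finite (pverts G)" and "stable G A"
  obtains S where "A \<subseteq> S" and "maximal_stable G S"
proof -
  have "\<forall>S. stable G S \<and> A \<subseteq> S \<longrightarrow> card S < Suc (stability_number G)"
    using stable_card_le_stability_number[OF fin] by (auto simp: less_Suc_eq_le)
  then obtain S where S: "stable G S" "A \<subseteq> S"
    and top: "\<And>S'. stable G S' \<and> A \<subseteq> S' \<Longrightarrow> card S' \<le> card S"
    using ex_has_greatest_nat[of "\<lambda>S. stable G S \<and> A \<subseteq> S" A card] \<open>stable G A\<close>
    by (metis order_refl)
  have "S' = S" if "stable G S'" "S \<subseteq> S'" for S'
    using card_seteq[OF stable_finite[OF fin that(1)] that(2)] top[of S'] that S(2) by auto
  then show thesis using that S unfolding maximal_stable_def by blast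
qed

section \<open>Partitions into edges and single vertices\<close>

text \<open>
  These are the partitions into cliques of a triangle-free graph. The set \<open>W\<close> is a parameter
  because the inductive construction works on vertex subsets of a fixed graph. The empty set is
  excluded from \<open>P\<close> by the last conjunct.
\<close>

definition edge_vertex_partition :: "'a pair_pre_digraph \<Rightarrow> 'a set \<Rightarrow> 'a set set \<Rightarrow> bool" where
  "edge_vertex_partition G W P \<longleftrightarrow> \<Union>P = W \<and> pairwise disjnt P \<and>
     (\<forall>e\<in>P. e \<in> uedges G \<or> (\<exists>v. e = {v}))"

lemma edge_vertex_partitionD:
  assumes "edge_vertex_partition G W P"
  shows "\<And>v. v \<in> W \<Longrightarrow> \<exists>e\<in>P. v \<in> e"
    and "\<And>e f v. e \<in> P \<Longrightarrow> f \<in> P \<Longrightarrow> v \<in> e \<Longrightarrow> v \<in> f \<Longrightarrow> e = f"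
    and "\<And>e. e \<in> P \<Longrightarrow> e \<subseteq> W"
  using assms unfolding edge_vertex_partition_def
  by (auto simp: pairwise_def disjnt_def)

lemma edge_vertex_partition_finite:
  "edge_vertex_partition G W P \<Longrightarrow> finite W \<Longrightarrow> finite P"
  unfolding edge_vertex_partition_def by (auto intro: finite_UnionD)

context pair_graph
begin

lemma stable_meets_part_once:
  assumes P: "edge_vertex_partition G W P" and S: "stable G S"
    and "e \<in> P" "x \<in> S \<inter> e" "y \<in> S \<inter> e"
  shows "x = y"
proof -
  from P \<open>e \<in> P\<close> consider u v where "(u, v) \<in> parcs G" "e = {u, v}" | v where "e = {v}"
    unfolding edge_vertex_partition_def uedges_def by blast
  then show ?thesis
  proof cases
    case 1
    then have "(v, u) \<in> parcs G" by (auto intro: arcs_symmetric)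
    with 1 assms S show ?thesis unfolding stable_def by auto
  qed (use assms in auto)
qed

text \<open>
  The second part is the form in which maximality of a stable set is exploited below: once \<open>P\<close> has
  as few parts as the stability number, a maximum stable set has a representative in each of them.
\<close>

lemma stable_card_le_partition:
  assumes "edge_vertex_partition G (pverts G) P" and "stable G S"
  shows "card S \<le> card P"
    and "card S = card P \<Longrightarrow> e \<in> P \<Longrightarrow> S \<inter> e \<noteq> {}"
proof -
  have sub: "S \<subseteq> \<Union>P"
    using assms unfolding edge_vertex_partition_def stable_def by blast
  note t = transversal_card_le[OF edge_vertex_partition_finite[OF assms(1) pair_finite_verts] sub
      stable_meets_part_once[OF assms]]
  show "card S \<le> card P" by (rule t(1))
  show "card S = card P \<Longrightarrow> e \<in> P \<Longrightarrow> S \<inter> e \<noteq> {}" by (rule t(2))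
qed

section \<open>Acyclic graphs\<close>

text \<open>
  The arc from \<open>y\<close> back to \<open>u\<close> would close the path to a cycle of length at least 3. All uses of
  acyclicity go through this fact.
\<close>

lemma acyclic_no_chord:
  assumes acyclic: "\<nexists>p. cycle p \<and> 3 \<le> length p"
    and "apath u q y" and "2 \<le> length q"
  shows "(y, u) \<notin> parcs G"
proof
  assume "(y, u) \<in> parcs G"
  then have "awalk y ((y, u) # q) y"
    using \<open>apath u q y\<close> by (auto simp: apath_def awalk_Cons_iff dest: wellformed')
  moreover have "distinct (tl (pawalk_verts y ((y, u) # q)))"
    using \<open>apath u q y\<close> by (simp add: apath_def)
  ultimately have "cycle ((y, u) # q)" unfolding cycle_def by blast
  with acyclic \<open>2 \<le> length q\<close> show False by auto
qed

text \<open>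
  The start \<open>u\<close> of a longest path inside \<open>W\<close> has this property: a neighbour of \<open>u\<close> in \<open>W\<close> lies on
  the path, as otherwise the path could be prolonged, and it is the second vertex of the path, as
  otherwise a chord would close a cycle.
\<close>

lemma acyclic_has_low_degree_vertex:
  assumes acyclic: "\<nexists>p. cycle p \<and> 3 \<le> length p"
    and W: "W \<subseteq> pverts G" "W \<noteq> {}"
  obtains v where "v \<in> W"
    and "\<And>x y. x \<in> W \<Longrightarrow> y \<in> W \<Longrightarrow> (v, x) \<in> parcs G \<Longrightarrow> (v, y) \<in> parcs G \<Longrightarrow> x = y"
proof -
  define path where "path = (\<lambda>(u, p). \<exists>v. apath u p v \<and> set (pawalk_verts u p) \<subseteq> W)"
  have finW: "finite W" using W(1) pair_finite_verts by (rule finite_subset)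
  from W obtain w where "w \<in> W" by blast
  then have "path (w, [])"
    using W(1) by (auto simp: path_def apath_def awalk_Nil_iff intro!: exI[of _ w])
  moreover have "length p < card W" if "path (u, p)" for u p
  proof -
    from that have "card (set (pawalk_verts u p)) = length (pawalk_verts u p)"
      unfolding path_def apath_def by (auto intro: distinct_card)
    moreover have "length (pawalk_verts u p) = Suc (length p)" by (induct p arbitrary: u) auto
    moreover have "card (set (pawalk_verts u p)) \<le> card W"
      using that finW by (auto simp: path_def intro: card_mono)
    ultimately show ?thesis by simp
  qed
  ultimately obtain u p where "path (u, p)"
    and longest: "\<And>u' p'. path (u', p') \<Longrightarrow> length p' \<le> length p"
    using ex_has_greatest_nat[of path "(w, [])" "\<lambda>(u, p). length p" "card W"] by fastforce
  then obtain v where p: "apath u p v" "set (pawalk_verts u p) \<subseteq> W"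
    unfolding path_def by auto
  have "u \<in> W" using p(2) by (cases p) (use p(1) in \<open>auto simp: apath_def awalk_Cons_iff\<close>)
  have neighbour: "\<exists>r. p = (u, y) # r" if y: "y \<in> W" "(u, y) \<in> parcs G" for y
  proof -
    have "(y, u) \<in> parcs G" using y by (auto intro: arcs_symmetric)
    have "y \<in> set (pawalk_verts u p)"
    proof (rule ccontr)
      assume new: "y \<notin> set (pawalk_verts u p)"
      have "awalk y ((y, u) # p) v"
        using p(1) \<open>(y, u) \<in> parcs G\<close> by (auto simp: apath_def awalk_Cons_iff dest: wellformed')
      with new p y(1) have "path (y, (y, u) # p)"
        unfolding path_def apath_def by auto
      from longest[OF this] show False by simp
    qed
    then obtain q r where qr: "p = q @ r" "awalk u q y" "awalk y r v"
      using awalk_decomp p(1) by (metis apath_def)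
    have "apath u q y"
      using p(1) qr by (auto simp: apath_append_iff)
    then have "length q < 2"
      using acyclic_no_chord[OF acyclic] \<open>(y, u) \<in> parcs G\<close> by force
    moreover have "q \<noteq> []"
      using qr(2) y(2) no_loops' by (auto simp: awalk_Nil_iff)
    ultimately obtain a where "q = [a]" by (cases q) auto
    with qr(1,2) show ?thesis by (cases a) (auto simp: awalk_Cons_iff awalk_Nil_iff)
  qed
  show thesis
  proof (rule that[OF \<open>u \<in> W\<close>])
    fix x y assume "x \<in> W" "y \<in> W" "(u, x) \<in> parcs G" "(u, y) \<in> parcs G"
    then obtain r r' where "p = (u, x) # r" "p = (u, y) # r'" using neighbour by meson
    then show "x = y" by simp
  qed
qed

text \<open>
  The equality of stability number and clique cover number for forests, by removing leaves. With
  \<open>v\<close> as in the previous lemma, \<open>v\<close> and its neighbour in \<open>W\<close>, if any, form a new part \<open>e\<close>, and \<open>v\<close>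
  can be added to any stable subset of \<open>W - e\<close>.
\<close>

lemma acyclic_partition_of_stable_size:
  assumes acyclic: "\<nexists>p. cycle p \<and> 3 \<le> length p"
    and "W \<subseteq> pverts G"
  shows "\<exists>P S. edge_vertex_partition G W P \<and> stable G S \<and> S \<subseteq> W \<and> card S = card P"
  using \<open>W \<subseteq> pverts G\<close>
proof (induct "card W" arbitrary: W rule: less_induct)
  case less
  have finW: "finite W" using less.prems pair_finite_verts by (rule finite_subset)
  show ?case
  proof (cases "W = {}")
    case True
    then have "edge_vertex_partition G W {}" "stable G {}"
      by (auto simp: edge_vertex_partition_def stable_def)
    then show ?thesis by (intro exI[of _ "{}"]) auto
  next
    case False
    obtain v where v: "v \<in> W"
      and low: "\<And>x y. x \<in> W \<Longrightarrow> y \<in> W \<Longrightarrow> (v, x) \<in> parcs G \<Longrightarrow> (v, y) \<in> parcs G \<Longrightarrow> x = y"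
      using acyclic_has_low_degree_vertex[OF acyclic less.prems False] by blast
    define e where "e = insert v {x \<in> W. (v, x) \<in> parcs G}"
    have "e \<in> uedges G \<or> e = {v}"
    proof (cases "\<exists>x\<in>W. (v, x) \<in> parcs G")
      case True
      then obtain x where "x \<in> W" "(v, x) \<in> parcs G" by blast
      with low have "e = {v, x}" by (auto simp: e_def)
      with \<open>(v, x) \<in> parcs G\<close> show ?thesis by (auto simp: uedges_def)
    qed (auto simp: e_def)
    have "e \<subseteq> W" "v \<in> e" using v by (auto simp: e_def)
    have "card (W - e) < card W"
      using finW \<open>v \<in> e\<close> v by (intro psubset_card_mono) auto
    with less.hyps[of "W - e"] less.prems obtain P S
      where P: "edge_vertex_partition G (W - e) P" and S: "stable G S" "S \<subseteq> W - e"
        and card: "card S = card P"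
      by blast
    have P': "edge_vertex_partition G W (insert e P)"
      using P \<open>e \<subseteq> W\<close> \<open>e \<in> uedges G \<or> e = {v}\<close>
      unfolding edge_vertex_partition_def by (auto simp: pairwise_insert disjnt_def)
    have nadj: "(v, x) \<notin> parcs G" "(x, v) \<notin> parcs G" if "x \<in> S" for x
      using that S(2) arcs_symmetric by (auto simp: e_def)
    have S': "stable G (insert v S)"
      using S(1) nadj v less.prems no_loops' unfolding stable_def by blast
    have "e \<notin> P" "v \<notin> S" using edge_vertex_partitionD(3)[OF P] \<open>v \<in> e\<close> S(2) by auto
    moreover have "finite P" using edge_vertex_partition_finite[OF P] finW by simp
    moreover have "finite S" using stable_finite[OF pair_finite_verts S(1)] .
    ultimately have "card (insert v S) = card (insert e P)" using card by simp
    with P' S' S(2) v show ?thesis by (intro exI[of _ "insert e P"] exI[of _ "insert v S"]) auto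
  qed
qed

lemma acyclic_stability_number_partition:
  assumes "\<nexists>p. cycle p \<and> 3 \<le> length p"
  obtains P where "edge_vertex_partition G (pverts G) P" and "card P = stability_number G"
proof -
  obtain P S where P: "edge_vertex_partition G (pverts G) P"
    and S: "stable G S" "card S = card P"
    using acyclic_partition_of_stable_size[OF assms subset_refl] by blast
  obtain A where "stable G A" "card A = stability_number G"
    using stability_number_attained[OF pair_finite_verts] .
  with stable_card_le_partition(1)[OF P] stable_card_le_stability_number[OF pair_finite_verts S(1)] S(2)
  have "card P = stability_number G" by fastforce
  with P show thesis by (rule that)
qed

section \<open>The square of a graph\<close>

lemma awalk_cost_unit: "awalk_cost (\<lambda>_. 1) p = real (length p)"
  by (induct p) auto

text \<open>
  The distance is an infimum of integers, so a value below 3 already yields a walk with at most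
  two arcs.
\<close>

lemma graph_dist_le_2_iff:
  assumes "v \<in> pverts G"
  shows "graph_dist G v w \<le> 2 \<longleftrightarrow>
    v = w \<or> (v, w) \<in> parcs G \<or> (\<exists>u. (v, u) \<in> parcs G \<and> (u, w) \<in> parcs G)"
    (is "_ \<longleftrightarrow> ?near")
proof
  show ?near if "graph_dist G v w \<le> 2"
  proof -
    note that
    also have "(2 :: ereal) < 3" by simp
    finally obtain p where p: "awalk v p w" and "ereal (real (length p)) < 3"
      unfolding graph_dist_def \<mu>_def INF_less_iff awalk_cost_unit by auto
    then have "length p < 3"
      by (metis ereal_less_eq(3) linorder_not_le numeral_eq_ereal of_nat_numeral of_nat_le_iff)
    then consider "p = []" | a where "p = [a]" | a b where "p = [a, b]"
      by (cases p; cases "tl p"; cases "tl (tl p)") auto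
    then show ?near
      using p by cases (auto simp: awalk_Cons_iff awalk_Nil_iff)
  qed
  show "graph_dist G v w \<le> 2" if ?near
  proof -
    from that have "\<exists>p. awalk v p w \<and> length p \<le> 2"
    proof (elim disjE exE conjE)
      assume "v = w"
      then show ?thesis
        using assms by (intro exI[of _ "[]"]) (auto simp: awalk_Nil_iff)
    next
      assume "(v, w) \<in> parcs G"
      then show ?thesis
        by (intro exI[of _ "[(v, w)]"]) (auto simp: awalk_Cons_iff awalk_Nil_iff dest: wellformed')
    next
      fix u assume "(v, u) \<in> parcs G" "(u, w) \<in> parcs G"
      then show ?thesis
        by (intro exI[of _ "[(v, u), (u, w)]"])
          (auto simp: awalk_Cons_iff awalk_Nil_iff dest: wellformed')
    qed
    then obtain p where p: "awalk v p w" "real (length p) \<le> 2" by auto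
    have "graph_dist G v w \<le> ereal (real (length p))"
      using min_cost_le_walk_cost[OF p(1), of "\<lambda>_. 1"] by (simp add: graph_dist_def awalk_cost_unit)
    also have "\<dots> \<le> 2" using p(2) by (metis ereal_less_eq(3) numeral_eq_ereal)
    finally show ?thesis .
  qed
qed

lemma graph_square_arc_iff:
  "(v, w) \<in> parcs (graph_square G) \<longleftrightarrow>
    v \<noteq> w \<and> ((v, w) \<in> parcs G \<or> (\<exists>u. (v, u) \<in> parcs G \<and> (u, w) \<in> parcs G))"
  unfolding graph_square_def using graph_dist_le_2_iff[of v w] by (auto dest: wellformed')

lemma pverts_graph_square [simp]: "pverts (graph_square G) = pverts G"
  by (simp add: graph_square_def)

lemma stable_graph_square_iff:
  "stable (graph_square G) S \<longleftrightarrow> stable G S \<and>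
    (\<forall>x\<in>S. \<forall>y\<in>S. \<forall>u. (x, u) \<in> parcs G \<longrightarrow> (u, y) \<in> parcs G \<longrightarrow> x = y)"
  unfolding stable_def graph_square_arc_iff using no_loops' by auto blast+

lemma stability_number_graph_square_le: "stability_number (graph_square G) \<le> stability_number G"
proof -
  have "finite (pverts (graph_square G))" using pair_finite_verts by simp
  then obtain S where "stable (graph_square G) S" "card S = stability_number (graph_square G)"
    by (rule stability_number_attained)
  then show ?thesis
    using stable_card_le_stability_number[OF pair_finite_verts, of S]
    by (simp add: stable_graph_square_iff)
qed

section \<open>Perfect matchings of pendant edges\<close>

lemma perfect_matching_partition:
  "perfect_matching G M \<Longrightarrow> edge_vertex_partition G (pverts G) M"
  unfolding perfect_matching_def matching_def edge_vertex_partition_def by auto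

lemma edge_partition_perfect_matching:
  assumes "edge_vertex_partition G (pverts G) P" and "\<And>v. {v} \<notin> P"
  shows "perfect_matching G P"
  using assms unfolding perfect_matching_def matching_def edge_vertex_partition_def by blast

lemma leaf_iff: "out_degree G x = 1 \<longleftrightarrow> (\<exists>y. \<forall>z. (x, z) \<in> parcs G \<longleftrightarrow> z = y)"
proof -
  have "out_arcs G x = Pair x ` {z. (x, z) \<in> parcs G}"
    by (auto simp: out_arcs_def)
  then have "out_degree G x = card {z. (x, z) \<in> parcs G}"
    unfolding out_degree_def by (simp add: card_image inj_on_def)
  then show ?thesis by (auto simp: card_1_singleton_iff set_eq_iff)
qed

lemma out_degree_nonzero_iff: "out_degree G x \<noteq> 0 \<longleftrightarrow> (\<exists>y. (x, y) \<in> parcs G)"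
proof -
  have "finite (out_arcs G x)"
    by (rule finite_subset[OF _ pair_finite_arcs]) (auto simp: out_arcs_def)
  then show ?thesis unfolding out_degree_def by (auto simp: out_arcs_def)
qed

lemma pendant_edgeI:
  assumes "(x, y) \<in> parcs G" and "\<And>z. (x, z) \<in> parcs G \<Longrightarrow> z = y"
  shows "pendant_edge G {x, y}"
proof -
  have "out_degree G x = 1" unfolding leaf_iff using assms by blast
  with assms(1) show ?thesis by (auto simp: pendant_edge_def uedges_def)
qed

lemma pendant_edge_leaf:
  assumes "pendant_edge G e"
  obtains x y where "e = {x, y}" "x \<noteq> y" "\<forall>z. (x, z) \<in> parcs G \<longleftrightarrow> z = y"
proof -
  from assms obtain u v x where uv: "(u, v) \<in> parcs G" "e = {u, v}" and x: "x \<in> e"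
    and "out_degree G x = 1"
    unfolding pendant_edge_def uedges_def by auto
  then obtain y where y: "\<forall>z. (x, z) \<in> parcs G \<longleftrightarrow> z = y" unfolding leaf_iff by blast
  have "u \<noteq> v" "(v, u) \<in> parcs G" using uv no_loops' by (auto intro: arcs_symmetric)
  with uv x y have "e = {x, y}" "x \<noteq> y" by auto
  then show thesis using y by (rule that)
qed

text \<open>
  Below, \<open>l e\<close> is a leaf of \<open>e\<close> and \<open>m e\<close> its only neighbour. A vertex joined to two chosen leaves
  would be the partner of both, so it would lie in two edges of the matching.
\<close>

lemma pendant_matching_square_stable_set:
  assumes M: "perfect_matching G M" and pendant: "\<forall>e\<in>M. pendant_edge G e"
  obtains L where "stable (graph_square G) L" and "card L = card M"
proof -
  note part = edge_vertex_partitionD[OF perfect_matching_partition[OF M]]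
  have "\<forall>e\<in>M. \<exists>x y. e = {x, y} \<and> x \<noteq> y \<and> (\<forall>z. (x, z) \<in> parcs G \<longleftrightarrow> z = y)"
    using pendant pendant_edge_leaf by metis
  then obtain l m where lm: "\<And>e. e \<in> M \<Longrightarrow> e = {l e, m e} \<and> l e \<noteq> m e"
    and l: "\<And>e z. e \<in> M \<Longrightarrow> (l e, z) \<in> parcs G \<longleftrightarrow> z = m e"
    by metis
  have mem: "l e \<in> e" "m e \<in> e" if "e \<in> M" for e using lm[OF that] by auto
  have "inj_on l M" by (rule inj_onI) (metis mem(1) part(2))
  moreover have "stable (graph_square G) (l ` M)"
    unfolding stable_graph_square_iff
  proof (intro conjI ballI allI impI)
    have "(l e, l f) \<notin> parcs G" if e: "e \<in> M" and f: "f \<in> M" for e f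
    proof
      assume "(l e, l f) \<in> parcs G"
      then have "l f = m e" using l[OF e] by simp
      then have "e = f" using part(2)[OF e f mem(2)[OF e]] mem(1)[OF f] by simp
      with \<open>l f = m e\<close> lm[OF e] show False by simp
    qed
    moreover have "l ` M \<subseteq> pverts G" using mem(1) part(3) by blast
    ultimately show "stable G (l ` M)" unfolding stable_def by blast
  next
    fix x y u assume "x \<in> l ` M" "y \<in> l ` M" and u: "(x, u) \<in> parcs G" "(u, y) \<in> parcs G"
    then obtain e f where ef: "e \<in> M" "f \<in> M" "x = l e" "y = l f" by blast
    have "(y, u) \<in> parcs G" using u(2) by (auto intro: arcs_symmetric)
    with u ef l have "m e = m f" by metis
    with ef mem(2) part(2) show "x = y" by metis
  qed
  ultimately show thesis using that by (metis card_image)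
qed

text \<open>
  The chain \<open>card M \<le> \<alpha>(G\<^sup>2) \<le> \<alpha>(G) \<le> card M\<close>.
\<close>

lemma pendant_matching_card:
  assumes M: "perfect_matching G M" and pendant: "\<forall>e\<in>M. pendant_edge G e"
  shows "stability_number G = card M" and "stability_number (graph_square G) = card M"
proof -
  obtain L where L: "stable (graph_square G) L" "card L = card M"
    using pendant_matching_square_stable_set[OF assms] .
  have "card M \<le> stability_number (graph_square G)"
    using stable_card_le_stability_number[OF _ L(1)] L(2) pair_finite_verts by simp
  moreover obtain S where "stable G S" "card S = stability_number G"
    using stability_number_attained[OF pair_finite_verts] .
  then have "stability_number G \<le> card M"
    using stable_card_le_partition(1)[OF perfect_matching_partition[OF M]] by metis
  ultimately show "stability_number G = card M" "stability_number (graph_square G) = card M"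
    using stability_number_graph_square_le by simp_all
qed

text \<open>
  If a maximal stable set missed the edge \<open>{x, y}\<close> of \<open>M\<close> with leaf \<open>x\<close>, then \<open>x\<close> could be added,
  since its only neighbour \<open>y\<close> is absent. So every maximal stable set is a transversal of \<open>M\<close>.
\<close>

lemma pendant_matching_very_well_covered:
  assumes M: "perfect_matching G M" and pendant: "\<forall>e\<in>M. pendant_edge G e"
  shows "very_well_covered G"
proof -
  note P = perfect_matching_partition[OF M]
  note part = edge_vertex_partitionD[OF P]
  have finM: "finite M" using edge_vertex_partition_finite[OF P pair_finite_verts] .
  have deg: "out_degree G v \<noteq> 0" if v: "v \<in> pverts G" for v
  proof -
    from part(1)[OF v] obtain e where "e \<in> M" "v \<in> e" by blast
    with M obtain a b where "(a, b) \<in> parcs G" "v = a \<or> v = b"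
      unfolding perfect_matching_def matching_def uedges_def by blast
    then show ?thesis unfolding out_degree_nonzero_iff by (auto intro: arcs_symmetric)
  qed
  have "card S = card M" if S: "maximal_stable G S" for S
  proof (rule antisym)
    from S have st: "stable G S" by (simp add: maximal_stable_def)
    then show "card S \<le> card M" using stable_card_le_partition(1)[OF P] by blast
    have "\<exists>x. x \<in> S \<inter> e" if e: "e \<in> M" for e
    proof (rule ccontr)
      assume empty: "\<nexists>x. x \<in> S \<inter> e"
      obtain x y where xy: "e = {x, y}" "x \<noteq> y" and x: "\<forall>z. (x, z) \<in> parcs G \<longleftrightarrow> z = y"
        using pendant_edge_leaf[OF bspec[OF pendant e]] .
      have "(x, s) \<notin> parcs G" "(s, x) \<notin> parcs G" if "s \<in> S" for s
        using that empty xy x arcs_symmetric by blast+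
      moreover have "x \<in> pverts G" using part(3)[OF e] xy by blast
      ultimately have "stable G (insert x S)"
        using st no_loops' unfolding stable_def by blast
      with S have "x \<in> S" unfolding maximal_stable_def by blast
      with empty xy show False by blast
    qed
    then obtain r where r: "\<And>e. e \<in> M \<Longrightarrow> r e \<in> S \<and> r e \<in> e" by (metis IntE)
    have "inj_on r M" by (rule inj_onI) (metis r part(2))
    then show "card M \<le> card S"
      using card_inj_on_le[of r M S] r stable_finite[OF pair_finite_verts st] by blast
  qed
  with deg have "well_covered G"
    unfolding well_covered_def pendant_matching_card(1)[OF assms] by simp
  moreover have "card (pverts G) = 2 * card M"
  proof -
    have "card e = 2" if "e \<in> M" for e
      using pendant_edge_leaf[OF bspec[OF pendant that]] by (metis card_2_iff)
    then have "card (\<Union>M) = (\<Sum>e\<in>M. 2)"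
      using M finM unfolding perfect_matching_def matching_def
      by (subst card_Union_disjoint) (auto intro: card_ge_0_finite)
    with M show ?thesis by (simp add: perfect_matching_def)
  qed
  ultimately show ?thesis
    unfolding very_well_covered_def pendant_matching_card(1)[OF assms] by simp
qed

section \<open>Well-covered and square-stable forests\<close>

text \<open>
  Both steps, excluding singleton parts and finding a leaf in each part, use the fact \<open>meets\<close>: for a stable set \<open>A\<close> and a part \<open>e\<close>, some stable
  superset of \<open>A\<close> meets \<open>e\<close>. Hence the vertices of \<open>e\<close> cannot all be adjacent to members of \<open>A\<close>.
\<close>

lemma acyclic_well_covered_pendant_matching:
  assumes acyclic: "\<nexists>p. cycle p \<and> 3 \<le> length p" and wc: "well_covered G"
  shows "\<exists>M. perfect_matching G M \<and> (\<forall>e\<in>M. pendant_edge G e)"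
proof -
  obtain P where P: "edge_vertex_partition G (pverts G) P" and card: "card P = stability_number G"
    using acyclic_stability_number_partition[OF acyclic] .
  have meets: "\<exists>S. stable G S \<and> A \<subseteq> S \<and> S \<inter> e \<noteq> {}" if "stable G A" "e \<in> P" for A e
  proof -
    obtain S where "A \<subseteq> S" "maximal_stable G S"
      using stable_extends_to_maximal[OF pair_finite_verts \<open>stable G A\<close>] .
    moreover from this have "stable G S" "card S = card P"
      using wc card by (auto simp: well_covered_def maximal_stable_def)
    moreover from this have "S \<inter> e \<noteq> {}"
      using stable_card_le_partition(2)[OF P _ _ \<open>e \<in> P\<close>] by simp
    ultimately show ?thesis by blast
  qed
  have "{v} \<notin> P" for v
  proof
    assume v: "{v} \<in> P"
    then have "v \<in> pverts G" using edge_vertex_partitionD(3)[OF P] by blast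
    with wc obtain w where w: "(v, w) \<in> parcs G"
      unfolding well_covered_def out_degree_nonzero_iff by blast
    then have "stable G {w}"
      using no_loops' by (auto simp: stable_def dest: wellformed')
    from meets[OF this v] w show False
      using arcs_symmetric unfolding stable_def by blast
  qed
  then have pm: "perfect_matching G P" using edge_partition_perfect_matching[OF P] by blast
  have "pendant_edge G e" if e: "e \<in> P" for e
  proof -
    from pm e obtain x y where xy: "(x, y) \<in> parcs G" "e = {x, y}"
      unfolding perfect_matching_def matching_def uedges_def by blast
    then have yx: "(y, x) \<in> parcs G" by (auto intro: arcs_symmetric)
    show ?thesis
    proof (rule ccontr)
      assume not_pendant: "\<not> pendant_edge G e"
      obtain a where a: "(x, a) \<in> parcs G" "a \<noteq> y"
        using pendant_edgeI[OF xy(1)] not_pendant xy(2) by blast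
      obtain b where b: "(y, b) \<in> parcs G" "b \<noteq> x"
        using pendant_edgeI[OF yx] not_pendant xy(2) by (metis insert_commute)
      have ax: "(a, x) \<in> parcs G" using a(1) by (auto intro: arcs_symmetric)
      have neq: "a \<noteq> x" "b \<noteq> y" "x \<noteq> y" using a b xy no_loops' by auto
      \<comment> \<open>The set \<open>{a, b}\<close> is stable: \<open>a = b\<close> would give a triangle, and \<open>a\<close> adjacent to \<open>b\<close> a 4-cycle.\<close>
      have "a \<noteq> b"
      proof
        assume "a = b"
        then have "apath x [(x, y), (y, a)] a"
          using xy a b neq by (auto simp: apath_def awalk_Cons_iff awalk_Nil_iff dest: wellformed')
        from acyclic_no_chord[OF acyclic this] ax show False by simp
      qed
      then have "apath a [(a, x), (x, y), (y, b)] b"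
        using xy a b ax neq by (auto simp: apath_def awalk_Cons_iff awalk_Nil_iff dest: wellformed')
      from acyclic_no_chord[OF acyclic this] have "(b, a) \<notin> parcs G" by simp
      then have "stable G {a, b}"
        using a b no_loops' arcs_symmetric by (auto simp: stable_def dest: wellformed')
      from meets[OF this e] obtain S s where "stable G S" "a \<in> S" "b \<in> S" "s \<in> S" "s = x \<or> s = y"
        using xy(2) by blast
      then show False using a(1) b(1) unfolding stable_def by blast
    qed
  qed
  with pm show ?thesis by blast
qed

text \<open>
  The hypothesis on isolated vertices excludes singleton parts; an edgeless graph is square-stable
  but has no perfect matching unless it is empty.
\<close>

lemma acyclic_square_stable_pendant_matching:
  assumes acyclic: "\<nexists>p. cycle p \<and> 3 \<le> length p"
    and no_isolated: "\<And>v. v \<in> pverts G \<Longrightarrow> \<exists>w. (v, w) \<in> parcs G"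
    and sq: "square_stable G"
  shows "\<exists>M. perfect_matching G M \<and> (\<forall>e\<in>M. pendant_edge G e)"
proof -
  obtain P where P: "edge_vertex_partition G (pverts G) P" and card: "card P = stability_number G"
    using acyclic_stability_number_partition[OF acyclic] .
  note part = edge_vertex_partitionD[OF P]
  have "finite (pverts (graph_square G))" using pair_finite_verts by simp
  then obtain S where S2: "stable (graph_square G) S" and "card S = stability_number (graph_square G)"
    by (rule stability_number_attained)
  with sq card have "card S = card P" by (simp add: square_stable_def)
  moreover from S2 have S: "stable G S"
    and far: "\<And>x y u. x \<in> S \<Longrightarrow> y \<in> S \<Longrightarrow> (x, u) \<in> parcs G \<Longrightarrow> (u, y) \<in> parcs G \<Longrightarrow> x = y"
    unfolding stable_graph_square_iff by blast+
  ultimately have meets: "S \<inter> e \<noteq> {}" if "e \<in> P" for e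
    using stable_card_le_partition(2)[OF P] that by blast
  \<comment> \<open>The representative \<open>s\<close> of the part of \<open>z\<close> is \<open>z\<close> or adjacent to \<open>z\<close>, hence within distance 2 of \<open>x\<close>.\<close>
  have same_part: "\<exists>e\<in>P. x \<in> e \<and> z \<in> e" if x: "x \<in> S" and xz: "(x, z) \<in> parcs G" for x z
  proof -
    have "z \<in> pverts G" using xz by (auto dest: wellformed')
    then obtain e where e: "e \<in> P" "z \<in> e" using part(1) by blast
    obtain s where s: "s \<in> S" "s \<in> e" using meets[OF e(1)] by blast
    have "z \<noteq> s" using S x xz s unfolding stable_def by blast
    moreover from P e(1) have "e \<in> uedges G \<or> (\<exists>v. e = {v})"
      unfolding edge_vertex_partition_def by blast
    ultimately have "(z, s) \<in> parcs G"
      using e s by (auto simp: uedges_def intro: arcs_symmetric)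
    with far x s xz have "x = s" by blast
    with e s show ?thesis by blast
  qed
  have "{v} \<notin> P" for v
  proof
    assume v: "{v} \<in> P"
    then have "v \<in> S" "v \<in> pverts G" using meets[OF v] part(3)[OF v] by auto
    with no_isolated obtain w where w: "(v, w) \<in> parcs G" by blast
    with same_part \<open>v \<in> S\<close> v part(2) have "w = v" by blast
    with w no_loops' show False by blast
  qed
  then have pm: "perfect_matching G P" using edge_partition_perfect_matching[OF P] by blast
  have "pendant_edge G e" if e: "e \<in> P" for e
  proof -
    obtain x where x: "x \<in> S" "x \<in> e" using meets[OF e] by blast
    from pm e obtain u v where uv: "(u, v) \<in> parcs G" "e = {u, v}"
      unfolding perfect_matching_def matching_def uedges_def by blast
    then obtain y where y: "(x, y) \<in> parcs G" "e = {x, y}"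
      using x(2) arcs_symmetric by blast
    have "z = y" if xz: "(x, z) \<in> parcs G" for z
    proof -
      have "z \<in> e" using same_part[OF x(1) xz] part(2) e x(2) by blast
      then show ?thesis using y(2) xz no_loops' by blast
    qed
    with y show ?thesis using pendant_edgeI by blast
  qed
  with pm show ?thesis by blast
qed

lemma connected_no_isolated_vertex:
  assumes "connected G" and "2 \<le> card (pverts G)" and v: "v \<in> pverts G"
  shows "\<exists>w. (v, w) \<in> parcs G"
proof -
  have "pverts G \<noteq> {v}" using assms(2) by auto
  with v obtain w where w: "w \<in> pverts G" "w \<noteq> v" by blast
  have "v \<rightarrow>\<^sup>*\<^bsub>mk_symmetric G\<^esub> w"
    using assms(1) v w(1) unfolding connected_def strongly_connected_def by simp
  then have "v \<rightarrow>\<^sup>*\<^bsub>with_proj G\<^esub> w" using reachable_mk_symmetric_eq[OF sym_arcs] by simp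
  then show ?thesis using w(2) by (cases rule: converse_reachable_cases) auto
qed

end

theorem corollary3p4:
  fixes T :: "'a pair_pre_digraph"
  assumes "graph_tree T"
    and "card (pverts T) \<ge> 2"
  shows "(well_covered T \<longleftrightarrow> very_well_covered T) \<and>
    (very_well_covered T \<longleftrightarrow>
      (\<exists>M. perfect_matching T M \<and> (\<forall>e\<in>M. pendant_edge T e))) \<and>
    ((\<exists>M. perfect_matching T M \<and> (\<forall>e\<in>M. pendant_edge T e)) \<longleftrightarrow> square_stable T)"
proof -
  from assms(1) interpret pair_graph T by (simp add: graph_tree_def)
  from assms(1) have acyclic: "\<nexists>p. cycle p \<and> 3 \<le> length p" and "connected T"
    by (simp_all add: graph_tree_def)
  then have no_isolated: "\<exists>w. (v, w) \<in> parcs T" if "v \<in> pverts T" for v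
    using connected_no_isolated_vertex assms(2) that by blast
  have "very_well_covered T" "square_stable T"
    if "perfect_matching T M" "\<forall>e\<in>M. pendant_edge T e" for M
    using that pendant_matching_very_well_covered pendant_matching_card
    by (simp_all add: square_stable_def)
  moreover have "very_well_covered T \<Longrightarrow> well_covered T" by (simp add: very_well_covered_def)
  ultimately show ?thesis
    using acyclic_well_covered_pendant_matching[OF acyclic]
      acyclic_square_stable_pendant_matching[OF acyclic no_isolated]
    by blast
qed

end
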